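(* Define integers $b_3(n)$ by $\sum_{n\ge 0} b_3(n)q^n = \prod_{i\ge 1}\frac{1-q^{3i}}{1-q^{i}}$. Then, coefficientwise modulo $2$, $$\sum_{n=0}^\infty b_3(26n+14)\,q^n \equiv \sum_{n=0}^\infty b_3(2n)\,q^{13n} \pmod 2.$$ Consequently $b_3(2\cdot 13^2 n+40)\equiv 0 \pmod 2$ for all $n\ge 0$, and more generally, for all integers $k\ge 1$ and $n\ge 0$, $$b_3\!\left(2\cdot 13^{2k} n + 13^{2k-2}\cdot 40 + 14\cdot\frac{13^{2k-2}-1}{168}\right)\equiv 0 \pmod 2.$$
   Context: A congruence $\sum a(n)q^n\equiv\sum c(n)q^n \pmod 2$ between power series means $a(n)\equiv c(n)\pmod 2$ for all $n$. *)

theory Defs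
  imports "HOL-Analysis.Infinite_Products" "HOL-Computational_Algebra.Formal_Laurent_Series"
    "HOL-Number_Theory.Cong"
begin

text \<open>
  The type \<^typ>\<open>int fps\<close> has no division, so \<open>1 / (1 - q ^ i)\<close> is written
  \<open>fps_left_inverse (1 - q ^ i) 1\<close>, where the last argument is the inverse of the constant
  coefficient. The product index is shifted, as \<^const>\<open>prodinf\<close> starts at 0. The limit
  is taken in the usual topology of power series, i.e. that of eventually constant coefficients.
\<close>

definition b3_factor :: "nat \<Rightarrow> int fps" where
  "b3_factor i = (1 - fps_X ^ (3 * i)) * fps_left_inverse (1 - fps_X ^ i) 1"

definition b3 :: "nat \<Rightarrow> int" where
  "b3 n = fps_nth (\<Prod>i. b3_factor (Suc i)) n"

definition fps_cong :: "int fps \<Rightarrow> int fps \<Rightarrow> int \<Rightarrow> bool" where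
  "fps_cong f g m \<longleftrightarrow> (\<forall>n. [fps_nth f n = fps_nth g n] (mod m))"

text \<open>The quotients and the infinite product are the intended ones.\<close>

lemma b3_factor_mult:
  assumes "i > 0"
  shows "b3_factor i * (1 - fps_X ^ i) = 1 - fps_X ^ (3 * i)"
proof -
  have "fps_left_inverse (1 - fps_X ^ i) 1 * (1 - fps_X ^ i :: int fps) = 1"
    using assms by (intro fps_left_inverse) simp
  then show ?thesis by (simp add: b3_factor_def mult.assoc)
qed

lemma b3_factor_eq:
  assumes "i > 0"
  shows "b3_factor i = 1 + fps_X ^ i * (b3_factor i - fps_X ^ (2 * i))"
proof -
  have *: "b = 1 + x * (b - y)" if "b * (1 - x) = 1 - x * y" for b x y :: "int fps"
    using that by (simp add: algebra_simps)
  have "fps_X ^ (3 * i) = fps_X ^ i * (fps_X ^ (2 * i) :: int fps)"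
    by (subst power_add [symmetric]) (rule arg_cong, simp)
  then show ?thesis
    using b3_factor_mult[OF assms] by (intro *) (simp only:)
qed

lemma b3_has_prod: "(\<lambda>i. b3_factor (Suc i)) has_prod Abs_fps b3"
proof -
  define P where "P n = (\<Prod>i\<le>n. b3_factor (Suc i))" for n
  have step: "fps_nth (P (Suc n)) k = fps_nth (P n) k" if "k \<le> Suc n" for n k
  proof -
    let ?m = "Suc (Suc n)"
    have "P (Suc n) = P n * b3_factor ?m"
      by (simp add: P_def)
    also have "\<dots> = P n * (1 + fps_X ^ ?m * (b3_factor ?m - fps_X ^ (2 * ?m)))"
      by (subst b3_factor_eq) (rule zero_less_Suc, rule refl)
    also have "\<dots> = P n + fps_X ^ ?m * (P n * (b3_factor ?m - fps_X ^ (2 * ?m)))"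
      by (simp only: distrib_left mult_1_right mult.left_commute)
    finally have "fps_nth (P (Suc n)) k =
        fps_nth (P n) k + fps_nth (fps_X ^ ?m * (P n * (b3_factor ?m - fps_X ^ (2 * ?m)))) k"
      by (simp only: fps_add_nth)
    then show ?thesis
      using that by (simp only: fps_X_power_mult_nth) simp
  qed
  have stable: "fps_nth (P n) k = fps_nth (P k) k" if "k \<le> n" for n k
    using that by (induction rule: dec_induct) (simp_all add: step)
  define L where "L = Abs_fps (\<lambda>k. fps_nth (P k) k)"
  have lim: "P \<longlonglongrightarrow> L"
  proof (rule tendsto_fpsI)
    show "\<forall>\<^sub>F n in sequentially. fps_nth (P n) k = fps_nth L k" for k
      using eventually_ge_at_top[of k]
      by (rule eventually_mono) (simp only: L_def fps_nth_Abs_fps, rule stable)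
  qed
  have "fps_nth L 0 = 1"
    by (simp add: L_def P_def b3_factor_def)
  then have "L \<noteq> 0" by auto
  have hp: "(\<lambda>i. b3_factor (Suc i)) has_prod L"
    using lim \<open>L \<noteq> 0\<close> by (simp add: has_prod_def raw_has_prod_def P_def[abs_def])
  have "(\<Prod>i. b3_factor (Suc i)) = L"
    using has_prod_unique[OF hp] by simp
  then have "Abs_fps b3 = L" by (simp add: b3_def fps_eq_iff)
  then show ?thesis using hp by simp
qed

end

theory Submission
  imports Defs "HOL-Library.Z2"
begin

text \<open>
  Write \<open>f d\<close> for \<open>\<Prod>(1 - q ^ (d * i))\<close> modulo 2, so that \<open>f (2 * d) = (f d)\<^sup>2\<close>. The Jacobi
  triple product gives \<open>f 3 ^ 3 / f 1 = \<Sum>q ^ (3 * k\<^sup>2 + 2 * k)\<close>, hence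
  \<open>f 3 / f 1 = (\<Sum>q ^ (3 * k\<^sup>2 + 2 * k)) / f 6\<close>, whose even part is \<open>f 4 / f 3\<close> after replacing
  \<open>q\<^sup>2\<close> by \<open>q\<close>. Splitting the triangular numbers modulo 3 yields \<open>f 1 ^ 3 = f 3 + q * f 9 ^ 3\<close>,
  and \<open>f 9 ^ 3 / f 3\<close> is again a theta series, so that
  \<open>\<Sum>b3 (2 * n) * q ^ n = f 4 / f 3 = f 1 * (1 + \<Sum>q ^ (3 * l + 1)\<^sup>2)\<close>.
  By the pentagonal number theorem, \<open>b3 (2 * n)\<close> therefore counts modulo 2 certain representations
  \<open>24 * n + 1 = x\<^sup>2 + 24 * y\<^sup>2\<close>. As 13 is inert in the quadratic field of
  discriminant -24, a multiple of 13 is represented only with both \<open>x\<close> and \<open>y\<close> divisible by 13.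
\<close>

unbundle no vec_syntax

section \<open>The Jacobi triple product\<close>

text \<open>A coefficient of a product involves only finitely many coefficients of the factors, and
  each of these is eventually constant.\<close>

lemma tendsto_mult_fps:
  fixes P R :: "'b \<Rightarrow> 'a::ring fps"
  assumes "(P \<longlongrightarrow> L) F" "(R \<longlongrightarrow> S) F"
  shows "((\<lambda>x. P x * R x) \<longlongrightarrow> L * S) F"
proof (rule tendsto_fpsI)
  fix n
  have P: "\<forall>\<^sub>F x in F. \<forall>i\<in>{..n}. P x $ i = L $ i"
    using assms(1) by (intro eventually_ball_finite) (auto simp: tendsto_fps_iff)
  have R: "\<forall>\<^sub>F x in F. \<forall>i\<in>{..n}. R x $ i = S $ i"
    using assms(2) by (intro eventually_ball_finite) (auto simp: tendsto_fps_iff)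
  from P R show "\<forall>\<^sub>F x in F. (P x * R x) $ n = (L * S) $ n"
    by eventually_elim (auto simp: fps_mult_nth intro!: sum.cong)
qed

lemma fps_X_power_dvd_iff:
  fixes f :: "'a::comm_ring_1 fps"
  shows "fps_X ^ m dvd f \<longleftrightarrow> (\<forall>i<m. f $ i = 0)"
proof
  assume *: "\<forall>i<m. f $ i = 0"
  have "f = fps_X ^ m * fps_shift m f"
    by (rule fps_ext) (use * in \<open>simp add: fps_X_power_mult_nth\<close>)
  then show "fps_X ^ m dvd f" by (rule dvdI)
qed (auto simp: fps_X_power_mult_nth elim!: dvdE)

section \<open>Gaussian binomial coefficients and the q-binomial theorem\<close>

definition qpoch :: "'a::comm_ring_1 \<Rightarrow> nat \<Rightarrow> 'a" where
  "qpoch q n = (\<Prod>i<n. 1 - q ^ Suc i)"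

text \<open>The q-Pascal recurrence avoids division, so the coefficients exist in every commutative
  ring. The usual quotient formula is recovered in multiplied form in
  \<open>gbinomial_q_mult_qpoch\<close>.\<close>

fun gbinomial_q :: "'a::comm_ring_1 \<Rightarrow> nat \<Rightarrow> nat \<Rightarrow> 'a" where
  "gbinomial_q q n 0 = 1"
| "gbinomial_q q 0 (Suc k) = 0"
| "gbinomial_q q (Suc n) (Suc k) = q ^ Suc k * gbinomial_q q n (Suc k) + gbinomial_q q n k"

lemma gbinomial_q_eq_0: "n < k \<Longrightarrow> gbinomial_q q n k = 0"
  by (induction q n k rule: gbinomial_q.induct) auto

lemma qpoch_Suc: "qpoch q (Suc n) = qpoch q n * (1 - q ^ Suc n)"
  by (simp add: qpoch_def)

text \<open>Both terms of the q-Pascal rule are known by induction; with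
  \<open>a = q ^ Suc j'\<close> and \<open>b = q ^ k\<close> they combine through
  \<open>a * (1 - b) + (1 - a) = 1 - a * b\<close>.\<close>

lemma gbinomial_q_mult_qpoch:
  "gbinomial_q q (j + k) j * (qpoch q j * qpoch q k) = qpoch q (j + k)"
proof (induction "j + k" arbitrary: j k)
  case 0
  then show ?case by (simp add: qpoch_def)
next
  case (Suc n)
  show ?case
  proof (cases j)
    case 0
    then show ?thesis by (simp add: qpoch_def)
  next
    case [simp]: (Suc j')
    have 1: "gbinomial_q q (j' + k) j' * (qpoch q j' * qpoch q k) = qpoch q (j' + k)"
      using Suc.hyps by auto
    have 2: "gbinomial_q q (j' + k) (Suc j') * (qpoch q (Suc j') * qpoch q k)
        = qpoch q (j' + k) * (1 - q ^ k)"
    proof (cases k)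
      case 0
      \<comment> \<open>Both sides vanish, the right one because
        \<open>1 - q ^ 0 = 0\<close>.\<close>
      then show ?thesis by (simp add: gbinomial_q_eq_0)
    next
      case [simp]: (Suc k')
      have "gbinomial_q q (Suc j' + k') (Suc j') * (qpoch q (Suc j') * qpoch q k')
          = qpoch q (Suc j' + k')"
        using Suc.hyps(1)[of "Suc j'" k'] Suc.hyps(2) by simp
      then have "gbinomial_q q (j' + k) (Suc j') * (qpoch q (Suc j') * qpoch q k') = qpoch q (j' + k)"
        by (simp only: add_Suc add_Suc_right Suc)
      then show ?thesis
        unfolding Suc qpoch_Suc[of q k'] by (metis mult.assoc)
    qed
    have "gbinomial_q q (j + k) j * (qpoch q j * qpoch q k) =
        q ^ Suc j' * (gbinomial_q q (j' + k) (Suc j') * (qpoch q (Suc j') * qpoch q k))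
        + (gbinomial_q q (j' + k) j' * (qpoch q j' * qpoch q k)) * (1 - q ^ Suc j')"
      by (simp add: qpoch_Suc algebra_simps)
    also have "\<dots> = qpoch q (j' + k) * (1 - q ^ Suc j' * q ^ k)"
      unfolding 1 2 by (simp add: algebra_simps)
    also have "\<dots> = qpoch q (j + k)"
      by (simp add: qpoch_Suc power_add mult.assoc)
    finally show ?thesis .
  qed
qed

text \<open>The homogeneous form admits \<open>y = q ^ n\<close> without division. Splitting off the
  factor \<open>i = 0\<close> leaves the same product with \<open>x * q\<close> in place of
  \<open>x\<close>.\<close>

theorem q_binomial:
  fixes x y q :: "'a::comm_ring_1"
  shows "(\<Prod>i<n. y + x * q ^ i) =
    (\<Sum>j\<le>n. gbinomial_q q n j * q ^ (j choose 2) * x ^ j * y ^ (n - j))"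
proof (induction n arbitrary: x)
  case 0
  show ?case by (simp add: numeral_2_eq_2)
next
  case (Suc n)
  let ?G = "gbinomial_q q n"
  define t where "t j = q ^ (j choose 2) * x ^ j" for j
  have t_Suc: "t (Suc j) = t j * q ^ j * x" for j
    by (simp add: t_def numeral_2_eq_2 power_add)
  have "(\<Prod>i<Suc n. y + x * q ^ i) = (y + x) * (\<Prod>i<n. y + (x * q) * q ^ i)"
    by (subst prod.lessThan_Suc_shift) (simp add: mult.assoc)
  also have "(\<Prod>i<n. y + (x * q) * q ^ i) = (\<Sum>j\<le>n. ?G j * t j * q ^ j * y ^ (n - j))"
    unfolding Suc.IH by (simp add: t_def power_mult_distrib mult_ac)
  also have "(y + x) * \<dots> = (\<Sum>j\<le>n. ?G j * t j * q ^ j * y ^ (Suc n - j))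
      + (\<Sum>j\<le>n. ?G j * t (Suc j) * y ^ (n - j))"
    unfolding distrib_right[of y x] unfolding sum_distrib_left
    by (intro arg_cong2[where f = "(+)"] sum.cong refl) (simp_all add: Suc_diff_le t_Suc mult_ac)
  also have "(\<Sum>j\<le>n. ?G j * t j * q ^ j * y ^ (Suc n - j))
      = (\<Sum>j\<le>Suc n. ?G j * t j * q ^ j * y ^ (Suc n - j))"
    by (simp add: gbinomial_q_eq_0)
  also have "\<dots> = t 0 * y ^ Suc n
      + (\<Sum>j\<le>n. ?G (Suc j) * t (Suc j) * q ^ Suc j * y ^ (n - j))"
    by (subst sum.atMost_Suc_shift) (simp add: mult_ac)
  also have "t 0 * y ^ Suc n + (\<Sum>j\<le>n. ?G (Suc j) * t (Suc j) * q ^ Suc j * y ^ (n - j))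
        + (\<Sum>j\<le>n. ?G j * t (Suc j) * y ^ (n - j))
      = t 0 * y ^ Suc n + (\<Sum>j\<le>n. gbinomial_q q (Suc n) (Suc j) * t (Suc j) * y ^ (n - j))"
    by (simp add: sum.distrib[symmetric] algebra_simps)
  also have "\<dots> = (\<Sum>j\<le>Suc n. gbinomial_q q (Suc n) j * t j * y ^ (Suc n - j))"
    by (subst sum.atMost_Suc_shift) simp
  finally show ?case by (simp add: t_def mult.assoc)
qed

section \<open>Triangular numbers and the finite triple product\<close>

text \<open>With integer index, \<open>tri k\<close> and \<open>tri (-k)\<close> are the two
  exponents in Ramanujan's general theta function. The value is never negative, so
  \<open>nat\<close> loses nothing.\<close>

definition tri :: "int \<Rightarrow> nat" where
  "tri k = nat (k * (k + 1) div 2)"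

lemma int_tri: "2 * int (tri k) = k * (k + 1)"
proof -
  have "0 \<le> k * (k + 1)"
    by (cases "k \<ge> 0") (auto intro: mult_nonpos_nonpos)
  then show ?thesis by (simp add: tri_def)
qed

text \<open>A crude bound that makes the fibres of theta exponents finite. It comes from
  \<open>(\<bar>k\<bar> - 1) * (\<bar>k\<bar> - 2) \<ge> 0\<close>, valid for every integer.\<close>

lemma tri_ge: "\<bar>k\<bar> - 1 \<le> int (tri k)"
proof -
  have "0 \<le> (\<bar>k\<bar> - 1) * (\<bar>k\<bar> - 2)"
    by (cases "\<bar>k\<bar> \<ge> 2") (auto intro: mult_nonpos_nonpos)
  moreover have "\<bar>k\<bar> * \<bar>k\<bar> = k * k" by simp
  ultimately show ?thesis
    using int_tri[of k] by (simp add: algebra_simps) 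
qed

lemma prod_lessThan_add:
  fixes f :: "nat \<Rightarrow> 'a::comm_monoid_mult"
  shows "(\<Prod>i<m + n. f i) = (\<Prod>i<m. f i) * (\<Prod>i<n. f (m + i))"
  by (induction n) (simp_all add: mult.assoc)

lemma int_choose_two: "2 * int (n choose 2) = int n * (int n - 1)"
  by (induct n) (simp_all add: numeral_2_eq_2 algebra_simps)

text \<open>In the q-binomial theorem with \<open>2 * n\<close> factors
  \<open>q ^ n + a * q ^ i\<close>, the first half, read backwards, yields the factors
  \<open>1 + b * q ^ i\<close> and the second half the factors \<open>1 + a * q ^ i\<close>, up to a
  monomial.\<close>

lemma jacobi_triple_finite:
  fixes a b :: "'a::idom"
  assumes "a \<noteq> 0" "b \<noteq> 0"
  shows "(\<Prod>i<n. (1 + a * (a * b) ^ i) * (1 + b * (a * b) ^ i)) =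
    (\<Sum>k\<in>{-int n..int n}. gbinomial_q (a * b) (2 * n) (nat (int n + k)) * (a ^ tri k * b ^ tri (-k)))"
    (is "?P = ?S")
proof -
  define q where "q = a * b"
  \<comment> \<open>The first half contributes \<open>a ^ n * q ^ (n choose 2)\<close> to this
    monomial, the second half \<open>q ^ (n * n)\<close>.\<close>
  define c where "c = a ^ n * q ^ (n * n + (n choose 2))"
  have "c \<noteq> 0" using assms by (simp add: c_def q_def)
  have "(\<Prod>i<n. q ^ i) = q ^ (n choose 2)"
    by (induction n) (simp_all add: numeral_2_eq_2 power_add mult_ac)
  then have pw: "(\<Prod>i<n. q ^ (n - Suc i)) = q ^ (n choose 2)"
    using prod.nat_diff_reindex[of "\<lambda>i. q ^ i" n] by simp
  have "(\<Prod>i<2*n. q ^ n + a * q ^ i)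
      = (\<Prod>i<n. q ^ n + a * q ^ (n - Suc i)) * (\<Prod>i<n. q ^ n + a * q ^ (n + i))"
    unfolding mult_2 prod_lessThan_add
    using prod.nat_diff_reindex[of "\<lambda>i. q ^ n + a * q ^ i" n] by simp
  also have "(\<Prod>i<n. q ^ n + a * q ^ (n - Suc i))
      = (\<Prod>i<n. (a * q ^ (n - Suc i)) * (1 + b * q ^ i))"
  proof (intro prod.cong refl)
    fix i assume "i \<in> {..<n}"
    then have "q ^ n = q ^ (n - Suc i) * q ^ Suc i"
      by (simp only: power_add[symmetric]) simp
    then show "q ^ n + a * q ^ (n - Suc i) = a * q ^ (n - Suc i) * (1 + b * q ^ i)"
      by (simp add: q_def algebra_simps)
  qed
  also have "(\<Prod>i<n. q ^ n + a * q ^ (n + i)) = (\<Prod>i<n. q ^ n * (1 + a * q ^ i))"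
    by (simp add: power_add algebra_simps)
  also have "(\<Prod>i<n. (a * q ^ (n - Suc i)) * (1 + b * q ^ i)) * (\<Prod>i<n. q ^ n * (1 + a * q ^ i)) = c * ?P"
    unfolding prod.distrib pw by (simp add: c_def power_add power_mult mult_ac flip: q_def)
  finally have "(\<Prod>i<2*n. q ^ n + a * q ^ i) = c * ?P" .
  also have "(\<Prod>i<2*n. q ^ n + a * q ^ i) = c * ?S"
    unfolding q_binomial sum_distrib_left \<comment> \<open>with \<open>x = a\<close> and \<open>y = q ^ n\<close>, shifting the index by \<open>n\<close>\<close>
  proof (rule sum.reindex_bij_witness[of _ "\<lambda>k. nat (int n + k)" "\<lambda>j. int j - int n"])
    fix j assume "j \<in> {..2 * n}"
    then have j: "j \<le> 2 * n" by simp
    define k where "k = int j - int n"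
    have jk: "int j = int n + k" by (simp add: k_def)
    \<comment> \<open>Doubling turns binomial coefficients and triangular numbers into polynomials
      in \<open>n\<close> and \<open>k\<close>.\<close>
    have "2 * int ((j choose 2) + n * (2 * n - j)) = 2 * int (n * n + (n choose 2) + tri (-k))"
      unfolding of_nat_add distrib_left int_choose_two int_tri of_nat_mult of_nat_diff[OF j] jk
      by (simp add: algebra_simps)
    then have b: "(j choose 2) + n * (2 * n - j) = n * n + (n choose 2) + tri (-k)"
      by (simp only: mult_cancel_left of_nat_eq_iff) simp
    have "2 * int (tri k) = 2 * int (tri (-k)) + 2 * k"
      unfolding int_tri by (simp add: algebra_simps)
    then have "tri k + n = tri (-k) + j"
      using jk by linarith
    then have a: "(j choose 2) + n * (2 * n - j) + j = n * n + (n choose 2) + tri k + n"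
      unfolding b by simp
    have "q ^ (j choose 2) * a ^ j * (q ^ n) ^ (2 * n - j)
        = a ^ ((j choose 2) + n * (2 * n - j) + j) * b ^ ((j choose 2) + n * (2 * n - j))"
      by (simp add: q_def power_add power_mult_distrib mult_ac flip: power_mult)
    also have "\<dots> = a ^ (n * n + (n choose 2) + tri k + n) * b ^ (n * n + (n choose 2) + tri (-k))"
      by (subst a, subst b) (rule refl)
    also have "\<dots> = c * (a ^ tri k * b ^ tri (-k))"
      by (simp add: c_def q_def power_add power_mult_distrib mult_ac)
    finally show "c * (gbinomial_q (a * b) (2 * n) (nat (int n + (int j - int n))) *
           (a ^ tri (int j - int n) * b ^ tri (- (int j - int n)))) =
          gbinomial_q q (2 * n) j * q ^ (j choose 2) * a ^ j * (q ^ n) ^ (2 * n - j)"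
      by (simp add: mult.assoc k_def q_def mult.left_commute[of c])
  qed auto
  finally show ?thesis using \<open>c \<noteq> 0\<close> by simp
qed

text \<open>Only meaningful when all fibres of \<open>e\<close> are finite, as \<^const>\<open>card\<close> is 0 on infinite sets.\<close>

definition theta :: "('i \<Rightarrow> nat) \<Rightarrow> 'a::semiring_1 fps" where
  "theta e = Abs_fps (\<lambda>m. of_nat (card {k. e k = m}))"

section \<open>Passage from the finite to the infinite triple product\<close>

text \<open>Divisibility of a difference by \<open>fps_X ^ Suc m\<close> expresses agreement of the
  coefficients up to \<open>m\<close>; the factors beyond the first \<open>m\<close> are 1 to this
  precision.\<close>

lemma qpoch_X_cong:
  assumes "d > 0" "m \<le> n"
  shows "fps_X ^ Suc m dvd (qpoch (fps_X ^ d) n - qpoch (fps_X ^ d) m :: 'a::comm_ring_1 fps)"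
  using assms(2)
proof (induction rule: dec_induct)
  case (step n)
  have "Suc m \<le> d * Suc n" using step.hyps assms(1)
    by (metis Suc_le_mono le_trans mult_le_mono1 nat_mult_1 One_nat_def Suc_leI)
  then have "fps_X ^ Suc m dvd (qpoch (fps_X ^ d) n * (fps_X ^ d) ^ Suc n :: 'a fps)"
    unfolding power_mult[symmetric] by (intro dvd_mult le_imp_power_dvd)
  from dvd_diff[OF step.IH this] show ?case
    by (simp add: qpoch_Suc algebra_simps)
qed simp

text \<open>Modulo \<open>fps_X ^ Suc m\<close> all Pochhammer products involved agree with
  \<open>P m\<close>, so the quotient formula reads \<open>G * P m * P m = P m\<close>, where the
  unit \<open>P m\<close> cancels.\<close>

lemma gbinomial_q_X_cong:
  fixes m :: nat and d :: nat
  assumes "d > 0" "m \<le> j" "m \<le> k" "m \<le> n"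
  shows "fps_X ^ Suc m dvd
    (gbinomial_q (fps_X ^ d) (j + k) j * qpoch (fps_X ^ d) n - 1 :: 'a::comm_ring_1 fps)"
proof -
  define M :: "'a fps" where "M = fps_X ^ Suc m"
  define P :: "nat \<Rightarrow> 'a fps" where "P = qpoch (fps_X ^ d)"
  define G :: "'a fps" where "G = gbinomial_q (fps_X ^ d) (j + k) j"
  have cong: "\<exists>t. P n = P m + M * t" if "m \<le> n" for n
    using qpoch_X_cong[OF assms(1) that, where 'a = 'a]
    unfolding M_def P_def by (metis add_diff_cancel_left' diff_add_cancel add.commute dvdE)
  obtain t1 where 1: "P j = P m + M * t1" using cong assms by blast
  obtain t2 where 2: "P k = P m + M * t2" using cong assms by blast
  obtain t3 where 3: "P n = P m + M * t3" using cong assms by blast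
  obtain t4 where 4: "P (j + k) = P m + M * t4" using cong[of "j + k"] assms by auto
  define v where "v = fps_left_inverse (P m) 1"
  have "P m $ 0 = 1"
    using assms(1) unfolding P_def by (induction m) (simp_all add: qpoch_Suc, simp add: qpoch_def)
  then have v: "v * P m = 1" unfolding v_def by (intro fps_left_inverse) simp
  define u where "u = t4 - G * (P m * t2 + t1 * P m + M * t1 * t2)"
  have "G * (P j * P k) = P (j + k)"
    unfolding G_def P_def by (rule gbinomial_q_mult_qpoch)
  then have "P m * (G * P m - 1) = M * (t4 - G * (P m * t2 + t1 * P m + M * t1 * t2))"
    unfolding 1 2 4 by (simp add: algebra_simps)
  then have *: "P m * (G * P m - 1) = M * u" unfolding u_def .
  have "G * P m - 1 = v * (P m * (G * P m - 1))"
    by (simp add: v flip: mult.assoc)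
  also have "\<dots> = M * (v * u)"
    unfolding * by (rule mult.left_commute)
  finally have "G * P n - 1 = M * (v * u + G * t3)"
    unfolding 3 by (simp add: algebra_simps)
  then have "M dvd G * P n - 1" by (rule dvdI)
  then show ?thesis unfolding M_def G_def P_def .
qed

text \<open>After multiplication by \<open>qpoch\<close>, the coefficients in the finite identity
  tend to 1. One of \<open>r\<close> and \<open>s\<close> may be 0, which \<open>euler_cube\<close>
  exploits.\<close>

theorem jacobi_triple:
  fixes r s :: nat
  assumes "r + s > 0"
  shows "(\<lambda>n. \<Prod>i<n. (1 + fps_X ^ (r + (r + s) * i)) * (1 + fps_X ^ (s + (r + s) * i))
      * (1 - fps_X ^ ((r + s) * Suc i)))
    \<longlonglongrightarrow> (theta (\<lambda>k. r * tri k + s * tri (-k)) :: 'a::idom fps)"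
    (is "?L \<longlonglongrightarrow> _")
proof (rule tendsto_fpsI)
  fix m
  define e where "e k = r * tri k + s * tri (-k)" for k
  have e_ge: "\<bar>k\<bar> \<le> int (e k) + 1" for k
  proof -
    have "tri k \<le> e k \<or> tri (-k) \<le> e k"
      using assms unfolding e_def
      by (metis add_is_0 le_add1 le_add2 le_trans mult_le_mono1 nat_mult_1 neq0_conv One_nat_def Suc_leI)
    then show ?thesis using tri_ge[of k] tri_ge[of "-k"] by auto
  qed
  define C :: "nat \<Rightarrow> int \<Rightarrow> 'a fps" where
    "C n k = gbinomial_q (fps_X ^ (r + s)) (2 * n) (nat (int n + k)) * qpoch (fps_X ^ (r + s)) n" for n k
  have L: "?L n = (\<Sum>k\<in>{-int n..int n}. C n k * fps_X ^ e k)" for n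
  proof -
    have "?L n = (\<Prod>i<n. (1 + fps_X ^ r * (fps_X ^ r * fps_X ^ s) ^ i) *
        (1 + fps_X ^ s * (fps_X ^ r * fps_X ^ s) ^ i)) * qpoch (fps_X ^ (r + s)) n"
      by (simp add: prod.distrib qpoch_def power_add power_mult)
    also have "\<dots> = (\<Sum>k\<in>{-int n..int n}. C n k * fps_X ^ e k)"
      by (subst jacobi_triple_finite)
        (auto simp: sum_distrib_left sum_distrib_right C_def e_def mult_ac power_add power_mult intro!: sum.cong)
    finally show ?thesis .
  qed
  show "\<forall>\<^sub>F n in sequentially. ?L n $ m = theta (\<lambda>k. r * tri k + s * tri (-k)) $ m"
    \<comment> \<open>If \<open>e k \<le> m\<close>, then \<open>\<bar>k\<bar> \<le> m + 1\<close>,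
      so that \<open>n + k\<close> and \<open>n - k\<close> are still at least
      \<open>m\<close>.\<close>
    using eventually_ge_at_top[of "2 * m + 2"]
  proof eventually_elim
    case (elim n)
    have C: "(C n k * fps_X ^ e k) $ m = (if e k = m then 1 else 0)" for k
    proof (cases "e k \<le> m")
      case True
      define j where "j = nat (int n + k)"
      define l where "l = nat (int n - k)"
      have "2 * n = j + l" "m \<le> j" "m \<le> l" "m \<le> n"
        using True e_ge[of k] elim by (auto simp: j_def l_def)
      with gbinomial_q_X_cong[OF assms this(2-4), where 'a = 'a]
      have "fps_X ^ Suc m dvd C n k - 1"
        by (simp add: C_def j_def)
      then have "(C n k - 1) $ (m - e k) = 0"
        unfolding fps_X_power_dvd_iff by auto
      then show ?thesis using True by (auto simp: fps_X_power_mult_right_nth split: if_splits)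
    qed (auto simp: fps_X_power_mult_right_nth)
    have "?L n $ m = (\<Sum>k\<in>{-int n..int n}. if e k = m then 1 else 0)"
      unfolding L fps_sum_nth
      by (simp only: C)
    also have "\<dots> = of_nat (card ({-int n..int n} \<inter> {k. e k = m}))"
      by (simp add: sum.If_cases)
    also have "k \<in> {-int n..int n}" if "e k = m" for k
      using e_ge[of k] that elim by auto
    then have "{-int n..int n} \<inter> {k. e k = m} = {k. e k = m}"
      by blast
    finally show ?case by (simp add: theta_def e_def)
  qed
qed

lemma theta_nth [simp]: "theta e $ m = of_nat (card {k. e k = m})"
  by (simp add: theta_def)

lemma X_power_mult_theta: "fps_X ^ c * theta e = (theta (\<lambda>k. c + e k) :: 'a::comm_ring_1 fps)"
proof (rule fps_ext)
  fix m
  have "{k. c + e k = m} = (if m < c then {} else {k. e k = m - c})" by auto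
  then show "(fps_X ^ c * theta e) $ m = (theta (\<lambda>k. c + e k) :: 'a fps) $ m"
    by (simp add: fps_X_power_mult_nth)
qed

lemma theta_mult:
  assumes "\<And>m. finite {k. e k = m}" "\<And>m. finite {l. e' l = m}"
  shows "theta e * theta e' = (theta (\<lambda>(k, l). e k + e' l) :: 'a::comm_ring_1 fps)"
proof (rule fps_ext)
  fix m
  have "{kl. (case kl of (k, l) \<Rightarrow> e k + e' l) = m} = (\<Union>i\<in>{0..m}. {k. e k = i} \<times> {l. e' l = m - i})"
    by auto
  moreover have "card \<dots> = (\<Sum>i=0..m. card ({k. e k = i} \<times> {l. e' l = m - i}))"
    using assms by (intro card_UN_disjoint) auto
  ultimately show "(theta e * theta e' :: 'a fps) $ m = theta (\<lambda>(k, l). e k + e' l) $ m"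
    by (simp add: fps_mult_nth card_cartesian_product)
qed

lemma finite_tri_combination:
  assumes "r + s > 0"
  shows "finite {k. r * tri k + s * tri (-k) = m}"
proof (rule finite_subset)
  show "{k. r * tri k + s * tri (-k) = m} \<subseteq> {-int m - 1..int m + 1}"
  proof
    fix k :: int
    assume "k \<in> {k. r * tri k + s * tri (-k) = m}"
    then have "tri k \<le> m \<or> tri (-k) \<le> m"
      using assms by (cases "r = 0") (auto intro: trans_le_add1 trans_le_add2)
    then have "\<bar>k\<bar> - 1 \<le> int m"
      using tri_ge[of k] tri_ge[of "-k"] by auto
    then show "k \<in> {-int m - 1..int m + 1}" by auto
  qed
qed simp

section \<open>Eta quotients modulo 2\<close>

lemma bit_fps_2 [simp]: "(2 :: bit fps) = 0"
  by (rule fps_ext) (simp add: fps_numeral_nth)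

lemma bit_fps_diff: "f - g = (f + g :: bit fps)"
  by (rule fps_ext) simp

lemma bit_fps_square_add: "(f + g)\<^sup>2 = (f\<^sup>2 + g\<^sup>2 :: bit fps)"
  by (simp add: power2_sum)

lemma of_int_bit_eq_0_iff: "of_int x = (0::bit) \<longleftrightarrow> [x = 0] (mod 2)"
proof (cases "even x")
  case True
  then show ?thesis by (auto simp: cong_0_iff elim!: evenE)
next
  case False
  then show ?thesis by (auto simp: cong_0_iff elim!: oddE)
qed

lemma of_int_bit_eq_iff: "of_int x = (of_int y :: bit) \<longleftrightarrow> [x = y] (mod 2)"
  using of_int_bit_eq_0_iff[of "x - y"]
  by (simp only: of_int_diff right_minus_eq cong_iff_dvd_diff diff_0_right)

text \<open>Over the field \<open>bit\<close>, squaring is additive and nonzero series can be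
  cancelled.\<close>

definition reduce2 :: "int fps \<Rightarrow> bit fps" where
  "reduce2 f = Abs_fps (\<lambda>n. of_int (f $ n))"

lemma reduce2_nth [simp]: "reduce2 f $ n = of_int (f $ n)"
  by (simp add: reduce2_def)

lemma reduce2_1 [simp]: "reduce2 1 = 1"
  by (rule fps_ext) auto

lemma reduce2_add: "reduce2 (f + g) = reduce2 f + reduce2 g"
  by (rule fps_ext) (simp del: add_bit_eq_xor)

lemma reduce2_diff: "reduce2 (f - g) = reduce2 f - reduce2 g"
  by (rule fps_ext) (simp del: add_bit_eq_xor)

lemma reduce2_mult: "reduce2 (f * g) = reduce2 f * reduce2 g"
  by (rule fps_ext) (simp add: fps_mult_nth del: add_bit_eq_xor mult_bit_eq_and)

lemma reduce2_prod: "reduce2 (\<Prod>i\<in>A. f i) = (\<Prod>i\<in>A. reduce2 (f i))"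
  by (induction A rule: infinite_finite_induct) (simp_all add: reduce2_mult)

lemma reduce2_X_power [simp]: "reduce2 (fps_X ^ n) = fps_X ^ n"
  by (rule fps_ext) simp

lemma reduce2_theta: "reduce2 (theta e) = theta e"
  by (rule fps_ext) simp

lemma tendsto_reduce2:
  assumes "(P \<longlongrightarrow> L) F"
  shows "((\<lambda>n. reduce2 (P n)) \<longlongrightarrow> reduce2 L) F"
proof (rule tendsto_fpsI)
  fix n
  have "\<forall>\<^sub>F x in F. P x $ n = L $ n" using assms by (simp add: tendsto_fps_iff)
  then show "\<forall>\<^sub>F x in F. reduce2 (P x) $ n = reduce2 L $ n"
    by eventually_elim simp
qed

section \<open>Euler products modulo 2\<close>

text \<open>
  The right-hand side is the pentagonal number series; \<open>eulerp_tendsto\<close> below identifies it with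
  the infinite product.
\<close>

definition euler :: "nat \<Rightarrow> bit fps" where
  "euler d = theta (\<lambda>k. d * tri k + 2 * d * tri (-k))"

abbreviation eulerp :: "nat \<Rightarrow> nat \<Rightarrow> bit fps" where
  "eulerp d n \<equiv> qpoch (fps_X ^ d) n"

lemma eulerp_eq: "eulerp d n = (\<Prod>i<n. 1 + fps_X ^ (d * Suc i))"
  by (simp only: qpoch_def bit_fps_diff power_mult)

lemma prod_lessThan_mult:
  fixes f :: "nat \<Rightarrow> 'a::comm_monoid_mult"
  shows "(\<Prod>i<c * n. f i) = (\<Prod>i<n. \<Prod>j<c. f (c * i + j))"
proof (induction n)
  case (Suc n)
  have "(\<Prod>i<c * n + c. f i) = (\<Prod>i<Suc n. \<Prod>j<c. f (c * i + j))"
    unfolding prod_lessThan_add Suc.IH by simp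
  then show ?case by (simp add: add.commute)
qed simp

lemma eulerp_mult:
  "eulerp d (c * n) = (\<Prod>i<n. \<Prod>j<c. 1 + fps_X ^ (d * Suc (c * i + j)))"
  unfolding eulerp_eq prod_lessThan_mult ..

text \<open>Grouping the factors in threes gives the triple product with \<open>r = d\<close> and
  \<open>s = 2 * d\<close>, hence the limit along multiples of 3. Stability of the coefficients
  extends it to the whole sequence.\<close>

lemma eulerp_tendsto:
  assumes "d > 0"
  shows "eulerp d \<longlonglongrightarrow> euler d"
proof (rule tendsto_fpsI)
  fix m
  have stable: "eulerp d n $ m = eulerp d m $ m" if "m \<le> n" for n
  proof -
    have "(eulerp d n - eulerp d m) $ m = 0"
      using qpoch_X_cong[OF assms that, where 'a = bit] unfolding fps_X_power_dvd_iff by blast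
    then show ?thesis by (simp only: fps_sub_nth right_minus_eq)
  qed
  have "(\<lambda>n. eulerp d (3 * n)) \<longlonglongrightarrow> euler d"
  proof -
    have "eulerp d (3 * n) = (\<Prod>i<n. (1 + fps_X ^ (d + (d + 2 * d) * i)) * (1 + fps_X ^ (2 * d + (d + 2 * d) * i))
      * (1 - fps_X ^ ((d + 2 * d) * Suc i)))" for n
      unfolding eulerp_mult bit_fps_diff
      by (intro prod.cong refl) (simp add: eval_nat_numeral algebra_simps)
    then show ?thesis
      using jacobi_triple[of d "2 * d", where 'a = bit] assms by (simp add: euler_def)
  qed
  then have "\<forall>\<^sub>F n in sequentially. eulerp d (3 * n) $ m = euler d $ m"
    by (simp add: tendsto_fps_iff)
  then obtain n where "n \<ge> m" "eulerp d (3 * n) $ m = euler d $ m"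
    unfolding eventually_sequentially by (meson le_cases order_refl)
  then have "eulerp d m $ m = euler d $ m"
    using stable[of "3 * n"] by simp
  with stable show "\<forall>\<^sub>F n in sequentially. eulerp d n $ m = euler d $ m"
    unfolding eventually_sequentially by auto
qed

lemma eulerp_mult_tendsto:
  assumes "d > 0" "c > 0"
  shows "(\<lambda>n. eulerp d (c * n)) \<longlonglongrightarrow> euler d"
  using LIMSEQ_subseq_LIMSEQ[OF eulerp_tendsto[OF assms(1)], of "\<lambda>n. c * n"] assms(2)
  by (simp add: strict_mono_def o_def)

lemma euler_nonzero: "d > 0 \<Longrightarrow> euler d \<noteq> 0"
proof
  assume "d > 0" "euler d = 0"
  then have "\<forall>\<^sub>F n in sequentially. eulerp d n $ 0 = 0"
    using eulerp_tendsto[of d] by (auto simp: tendsto_fps_iff)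
  moreover have "eulerp d n $ 0 = 1" for n
    using \<open>d > 0\<close> by (induction n) (simp_all add: qpoch_Suc, simp add: qpoch_def)
  ultimately show False by simp
qed

text \<open>Squaring a factor \<open>1 + fps_X ^ i\<close> doubles its exponent in characteristic
  2.\<close>

lemma euler_double: "d > 0 \<Longrightarrow> euler (2 * d) = (euler d)\<^sup>2"
proof (rule LIMSEQ_unique)
  assume "d > 0"
  have "eulerp (2 * d) n = (\<Prod>i<n. (1 + fps_X ^ (d * Suc i))\<^sup>2)" for n
    unfolding eulerp_eq bit_fps_square_add power_mult[symmetric]
    by (intro prod.cong refl) (simp add: algebra_simps)
  then have "eulerp (2 * d) n = eulerp d n * eulerp d n" for n
    by (simp only: eulerp_eq prod.distrib power2_eq_square)
  then show "eulerp (2 * d) \<longlonglongrightarrow> (euler d)\<^sup>2"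
    using tendsto_mult_fps[OF eulerp_tendsto eulerp_tendsto, of d d] \<open>d > 0\<close>
    by (simp add: power2_eq_square)
qed (use eulerp_tendsto[of "2 * d"] in auto)

section \<open>Theta series as eta quotients\<close>

text \<open>The triple product runs over \<open>d\<close> times the integers congruent to 0, 1 or 5
  modulo 6. Inclusion-exclusion over multiples of 2 and 3 gives
  \<open>f d * f (6 * d) ^ 2 / (f (2 * d) * f (3 * d))\<close>, which \<open>euler_double\<close>
  simplifies.\<close>

lemma theta_5_1:
  assumes "d > 0"
  shows "theta (\<lambda>k. 5 * d * tri k + d * tri (-k)) * euler d = euler (3 * d) ^ 3"
proof -
  let ?T = "theta (\<lambda>k. 5 * d * tri k + d * tri (-k)) :: bit fps"
  define L :: "nat \<Rightarrow> bit fps" where "L n =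
    (\<Prod>i<n. (1 + fps_X ^ (5 * d + (5 * d + d) * i)) * (1 + fps_X ^ (d + (5 * d + d) * i))
      * (1 - fps_X ^ ((5 * d + d) * Suc i)))" for n
  have L: "L \<longlonglongrightarrow> ?T"
    unfolding L_def by (rule jacobi_triple) (use assms in simp)
  have expand:
    "(\<Prod>j<2. f j) = f 0 * f 1"
    "(\<Prod>j<3. f j) = f 0 * f 1 * f 2"
    "(\<Prod>j<6. f j) = f 0 * f 1 * f 2 * f 3 * f 4 * f 5"
    "(\<Prod>j<Suc 0. f j) = f 0" for f :: "nat \<Rightarrow> bit fps"
    by (simp_all add: eval_nat_numeral)
  \<comment> \<open>Each product covers \<open>n\<close> periods modulo 6. Writing
    \<open>Suc 0 * n\<close> lets \<open>eulerp_mult\<close> apply with blocks of length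
    one.\<close>
  have "L n * eulerp (2 * d) (3 * n) * eulerp (3 * d) (2 * n)
      = eulerp d (6 * n) * eulerp (6 * d) (Suc 0 * n) * eulerp (6 * d) (Suc 0 * n)" for n
    unfolding L_def eulerp_mult prod.distrib[symmetric] bit_fps_diff expand
    by (intro prod.cong refl) (simp add: add_mult_distrib add_mult_distrib2 mult_ac add_ac)
  moreover have "(\<lambda>n. L n * eulerp (2 * d) (3 * n) * eulerp (3 * d) (2 * n))
      \<longlonglongrightarrow> ?T * euler (2 * d) * euler (3 * d)"
    using assms by (intro tendsto_mult_fps L eulerp_mult_tendsto) auto
  moreover have "(\<lambda>n. eulerp d (6 * n) * eulerp (6 * d) (Suc 0 * n) * eulerp (6 * d) (Suc 0 * n))
      \<longlonglongrightarrow> euler d * euler (6 * d) * euler (6 * d)"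
    using assms by (intro tendsto_mult_fps eulerp_mult_tendsto) auto
  ultimately have "?T * euler (2 * d) * euler (3 * d) = euler d * euler (6 * d) * euler (6 * d)"
    using LIMSEQ_unique by auto
  then have "(?T * euler d) * (euler d * euler (3 * d)) = euler (3 * d) ^ 3 * (euler d * euler (3 * d))"
    using euler_double[of d] euler_double[of "3 * d"] assms
    by (simp add: power2_eq_square power3_eq_cube mult_ac)
  then show ?thesis
    using euler_nonzero assms by simp
qed

lemma tri_reflect: "tri (-1 - k) = tri k"
  by (simp add: tri_def algebra_simps)

text \<open>The reflection of \<open>tri_reflect\<close> exchanges the negative and the nonnegative
  solutions.\<close>

lemma card_int_tri:
  assumes "d > 0"
  shows "card {k :: int. d * tri k = m} = 2 * card {n :: nat. d * tri (int n) = m}"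
proof -
  let ?A = "{n :: nat. d * tri (int n) = m}"
  have 1: "{k. d * tri k = m} = int ` ?A \<union> (\<lambda>n. -1 - int n) ` ?A"
  proof (intro equalityI subsetI)
    fix k :: int assume k: "k \<in> {k. d * tri k = m}"
    show "k \<in> int ` ?A \<union> (\<lambda>n. -1 - int n) ` ?A"
    proof (cases "k \<ge> 0")
      case True
      then show ?thesis using k by (auto intro!: image_eqI[of _ _ "nat k"])
    next
      case False
      then show ?thesis using k tri_reflect[of k] by (intro UnI2 image_eqI[of _ _ "nat (-1 - k)"]) auto
    qed
  qed (auto simp: tri_reflect)
  have "finite {k. d * tri k = m}"
    using finite_tri_combination[of d 0 m] assms by simp
  then have "finite (int ` ?A)" unfolding 1 by simp
  then have fin: "finite ?A" by (simp add: finite_image_iff)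
  show ?thesis
    unfolding 1 using fin by (subst card_Un_disjoint) (auto simp: card_image inj_on_def)
qed

text \<open>This is Gauss's product for the triangular number series, from the triple product with
  \<open>r = d\<close> and \<open>s = 0\<close>; modulo 2 its three products all become
  \<open>euler d\<close>.\<close>

lemma euler_cube:
  assumes "d > 0"
  shows "euler d ^ 3 = theta (\<lambda>n :: nat. d * tri (int n))"
proof -
  let ?\<psi> = "\<lambda>n :: nat. d * tri (int n)"
  define A :: "nat \<Rightarrow> int fps" where "A n = (\<Prod>i<n. 1 + fps_X ^ (d * Suc i))" for n
  define q :: "nat \<Rightarrow> int fps" where "q n = (\<Prod>i<n. 1 - fps_X ^ (d * Suc i))" for n
  text \<open>The factor for \<open>i = 0\<close> is 2, so this case of the triple product must be halved over the integers.\<close>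
  have shift: "(\<Prod>i<Suc n. 1 + fps_X ^ (d * i)) = (2 * A n :: int fps)" for n
    by (subst prod.lessThan_Suc_shift) (simp add: A_def)
  have "(\<lambda>n. \<Prod>i<n. (1 + fps_X ^ (d + (d + 0) * i)) * (1 + fps_X ^ (0 + (d + 0) * i))
      * (1 - fps_X ^ ((d + 0) * Suc i))) \<longlonglongrightarrow> (theta (\<lambda>k. d * tri k + 0 * tri (-k)) :: int fps)"
    by (rule jacobi_triple) (use assms in simp)
  then have "(\<lambda>n. A n * (\<Prod>i<n. 1 + fps_X ^ (d * i)) * q n) \<longlonglongrightarrow> (theta (\<lambda>k. d * tri k) :: int fps)"
    by (simp add: prod.distrib A_def q_def)
  then have "(\<lambda>n. A (Suc n) * (2 * A n) * q (Suc n)) \<longlonglongrightarrow> (theta (\<lambda>k. d * tri k) :: int fps)"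
    by (drule_tac LIMSEQ_Suc) (simp only: shift)
  moreover have "theta (\<lambda>k. d * tri k) = (2 * theta ?\<psi> :: int fps)"
    by (rule fps_ext) (simp only: mult_2 fps_add_nth theta_nth card_int_tri[OF assms] of_nat_add)
  moreover have "A (Suc n) * (2 * A n) * q (Suc n) = 2 * (A (Suc n) * A n * q (Suc n))" for n
    by simp
  ultimately have "(\<lambda>n. 2 * (A (Suc n) * A n * q (Suc n))) \<longlonglongrightarrow> (2 * theta ?\<psi> :: int fps)"
    by simp
  then have "(\<lambda>n. A (Suc n) * A n * q (Suc n)) \<longlonglongrightarrow> (theta ?\<psi> :: int fps)"
    unfolding tendsto_fps_iff mult_2 fps_add_nth by simp
  from tendsto_reduce2[OF this]
  have "(\<lambda>n. eulerp d (Suc n) * eulerp d n * eulerp d (Suc n)) \<longlonglongrightarrow> theta ?\<psi>"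
    by (simp only: A_def q_def reduce2_mult reduce2_prod reduce2_diff reduce2_add reduce2_1
        reduce2_X_power reduce2_theta bit_fps_diff eulerp_eq)
  moreover have "(\<lambda>n. eulerp d (Suc n) * eulerp d n * eulerp d (Suc n)) \<longlonglongrightarrow> euler d * euler d * euler d"
    using assms by (intro tendsto_mult_fps LIMSEQ_Suc eulerp_tendsto)
  ultimately show ?thesis
    using LIMSEQ_unique by (auto simp: power3_eq_cube)
qed

section \<open>The generating function of \<open>b3 (2 * n)\<close> modulo 2\<close>

lemma reduce2_b3: "reduce2 (Abs_fps b3) * euler 1 = euler 3"
proof -
  have "(\<lambda>n. \<Prod>i\<le>n. b3_factor (Suc i)) \<longlonglongrightarrow> Abs_fps b3"
    using b3_has_prod by (rule has_prod_imp_tendsto)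
  from tendsto_mult_fps[OF tendsto_reduce2[OF this] LIMSEQ_Suc[OF eulerp_tendsto[of 1]]]
  have "(\<lambda>n. reduce2 (\<Prod>i\<le>n. b3_factor (Suc i)) * eulerp 1 (Suc n))
      \<longlonglongrightarrow> reduce2 (Abs_fps b3) * euler 1" by simp
  moreover have "reduce2 (\<Prod>i\<le>n. b3_factor (Suc i)) * eulerp 1 (Suc n) = eulerp 3 (Suc n)" for n
  proof -
    have "reduce2 (b3_factor (Suc i)) * (1 + fps_X ^ Suc i) = 1 + fps_X ^ (3 * Suc i)" for i
      using arg_cong[OF b3_factor_mult[of "Suc i"], of reduce2]
      by (simp only: reduce2_mult reduce2_diff reduce2_1 reduce2_X_power bit_fps_diff zero_less_Suc)
    then show ?thesis
      by (simp only: eulerp_eq reduce2_prod lessThan_Suc_atMost prod.distrib[symmetric] nat_mult_1)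
  qed
  moreover have "(\<lambda>n. eulerp 3 (Suc n)) \<longlonglongrightarrow> euler 3"
    using eulerp_tendsto[of 3] by (intro LIMSEQ_Suc) simp
  ultimately show ?thesis using LIMSEQ_unique by auto
qed

text \<open>The hypotheses say that \<open>g\<close> is \<open>h\<close> at the square of the
  variable; multiplication by such a series commutes with taking even parts.\<close>

lemma bisection_mult:
  fixes f g h :: "'a::comm_ring_1 fps"
  assumes "\<And>n. g $ (2 * n) = h $ n" "\<And>n. odd n \<Longrightarrow> g $ n = 0"
  shows "(f * g) $ (2 * n) = (Abs_fps (\<lambda>n. f $ (2 * n)) * h) $ n"
proof -
  have "(f * g) $ (2 * n) = (\<Sum>i\<in>{0..2 * n}. f $ i * g $ (2 * n - i))"
    by (simp add: fps_mult_nth)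
  also have "\<dots> = (\<Sum>i\<in>(*) 2 ` {0..n}. f $ i * g $ (2 * n - i))"
  proof (intro sum.mono_neutral_right ballI)
    fix i assume "i \<in> {0..2 * n} - (*) 2 ` {0..n}"
    then have "odd i" "i \<le> 2 * n" by (auto elim!: evenE)
    then show "f $ i * g $ (2 * n - i) = 0" by (simp add: assms(2))
  qed auto
  also have "\<dots> = (\<Sum>i=0..n. f $ (2 * i) * g $ (2 * (n - i)))"
    by (subst sum.reindex) (auto simp: inj_on_def diff_mult_distrib2)
  finally show ?thesis by (simp add: fps_mult_nth assms(1))
qed

text \<open>The exponent \<open>3 * k\<^sup>2 + 2 * k\<close> is even only for even
  \<open>k\<close>, and \<open>k = -2 * l\<close> makes it twice the exponent
  \<open>6 * l\<^sup>2 - 2 * l\<close> of \<open>euler 4\<close>.\<close>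

lemma theta_5_1_even: "(theta (\<lambda>k. 5 * tri k + tri (-k)) :: bit fps) $ (2 * n) = euler 4 $ n"
proof -
  have eq: "int (5 * tri k + tri (-k)) = 3 * k\<^sup>2 + 2 * k"
    "int (4 * tri k + 8 * tri (-k)) = 6 * k\<^sup>2 - 2 * k" for k
    using int_tri[of k] int_tri[of "-k"] by (simp_all add: power2_eq_square algebra_simps)
  have "{k. 5 * tri k + tri (-k) = 2 * n} = (\<lambda>l. -2 * l) ` {l. 4 * tri l + 8 * tri (-l) = n}"
  proof (intro equalityI subsetI)
    fix k assume "k \<in> {k. 5 * tri k + tri (-k) = 2 * n}"
    then have k: "3 * k\<^sup>2 + 2 * k = 2 * int n" by (simp flip: eq)
    then have "even (3 * k\<^sup>2 + 2 * k)" by simp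
    then obtain m where m: "k = 2 * m" by (auto elim!: evenE)
    have "int (4 * tri (-m) + 8 * tri (-(-m))) = int n"
      unfolding eq using k by (simp add: m power2_eq_square)
    then show "k \<in> (\<lambda>l. -2 * l) ` {l. 4 * tri l + 8 * tri (-l) = n}"
      unfolding of_nat_eq_iff using m by (intro image_eqI[of _ _ "-m"]) auto
  next
    fix k assume "k \<in> (\<lambda>l. -2 * l) ` {l. 4 * tri l + 8 * tri (-l) = n}"
    then obtain l where l: "k = -2 * l" "4 * tri l + 8 * tri (-l) = n" by auto
    have "int (5 * tri k + tri (-k)) = int (2 * n)"
      unfolding eq using l(1) arg_cong[OF l(2), of int] eq(2)[of l] by (simp add: power2_eq_square)
    then show "k \<in> {k. 5 * tri k + tri (-k) = 2 * n}" unfolding of_nat_eq_iff by simp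
  qed
  then show ?thesis
    by (simp add: euler_def card_image inj_on_def)
qed

lemma euler_3_split: "euler 1 ^ 3 = euler 3 + fps_X * euler 9 ^ 3"
proof -
  \<comment> \<open>\<open>f\<close> enumerates the indices congruent to 0 or 2 modulo 3, whose
    triangular numbers are 3 times the generalized pentagonal numbers; \<open>g\<close> enumerates
    the remaining class.\<close>
  define f :: "int \<Rightarrow> nat" where "f k = nat (if k > 0 then 3 * k - 1 else - 3 * k)" for k
  define g :: "nat \<Rightarrow> nat" where "g n = 3 * n + 1" for n
  have f: "tri (int (f k)) = 3 * tri k + 6 * tri (-k)" for k
  proof -
    have "2 * int (tri (int (f k))) = 3 * (2 * int (tri k)) + 6 * (2 * int (tri (-k)))"
      unfolding int_tri by (simp add: f_def algebra_simps)
    then show ?thesis by linarith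
  qed
  have g: "tri (int (g n)) = 1 + 9 * tri (int n)" for n
  proof -
    have "2 * int (tri (int (g n))) = 2 + 9 * (2 * int (tri (int n)))"
      unfolding int_tri by (simp add: g_def algebra_simps)
    then show ?thesis by linarith
  qed
  have range: "range f \<union> range g = UNIV"
  proof (intro equalityI subsetI UNIV_I)
    fix n :: nat
    have "(\<exists>k. n = 3 * k) \<or> (\<exists>k. n = 3 * k + 1) \<or> (\<exists>k. n = 3 * k + 2)"
      by presburger
    then consider k where "n = 3 * k" | k where "n = 3 * k + 1" | k where "n = 3 * k + 2"
      by blast
    then show "n \<in> range f \<union> range g"
    proof cases
      case 1
      then have "n = f (- int k)" by (simp add: f_def)
      then show ?thesis by blast
    next
      case 2
      then have "n = g k" by (simp add: g_def)
      then show ?thesis by blast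
    next
      case 3
      then have "n = f (int k + 1)" by (simp add: f_def)
      then show ?thesis by blast
    qed
  qed
  have int_f: "int (f k) = (if k > 0 then 3 * k - 1 else - 3 * k)" for k
    by (simp add: f_def)
  have disj: "f k \<noteq> g n" for k n
  proof
    assume "f k = g n"
    then have "int (f k) = 3 * int n + 1" by (simp add: g_def)
    then show False unfolding int_f by presburger
  qed
  have "inj f"
  proof (rule injI)
    fix k l assume "f k = f l"
    then have "int (f k) = int (f l)" by simp
    then show "k = l" unfolding int_f by presburger
  qed
  moreover have "inj g" by (simp add: g_def inj_def)
  ultimately have inj: "inj f" "inj g" .
  have "card {n. 1 * tri (int n) = m} = card {k. 3 * tri k + 2 * 3 * tri (-k) = m}
      + card {n. 1 + 9 * tri (int n) = m}" for m
  proof -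
    have 1: "{n. 1 * tri (int n) = m} = f ` {k. 3 * tri k + 2 * 3 * tri (-k) = m}
        \<union> g ` {n. 1 + 9 * tri (int n) = m}" (is "?A = f ` ?B \<union> g ` ?C")
    proof (intro equalityI subsetI)
      fix n assume "n \<in> ?A"
      moreover have "n \<in> range f \<union> range g" using range by blast
      ultimately show "n \<in> f ` ?B \<union> g ` ?C" by (auto simp: f g)
    qed (auto simp: f g)
    have "?A \<subseteq> {..Suc m}"
    proof
      fix n assume "n \<in> ?A"
      then show "n \<in> {..Suc m}" using tri_ge[of "int n"] by auto
    qed
    then have "finite ?A" by (rule finite_subset) simp
    then have "finite (f ` ?B)" "finite (g ` ?C)" unfolding 1 by auto
    then show ?thesis
      unfolding 1 using disj inj
      by (subst card_Un_disjoint) (auto simp: card_image inj_on_subset dest: injD)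
  qed
  then have "theta (\<lambda>n :: nat. 1 * tri (int n)) =
      (theta (\<lambda>k. 3 * tri k + 2 * 3 * tri (-k)) + theta (\<lambda>n :: nat. 1 + 9 * tri (int n)) :: bit fps)"
    by (intro fps_ext) (simp del: add_bit_eq_xor)
  also have "theta (\<lambda>n :: nat. 1 + 9 * tri (int n)) = (fps_X * euler 9 ^ 3 :: bit fps)"
    using X_power_mult_theta[of 1 "\<lambda>n :: nat. 9 * tri (int n)", where 'a = bit]
    by (simp add: euler_cube)
  finally show ?thesis
    by (simp add: euler_cube) (simp add: euler_def)
qed

lemma b3_even_eq:
  "Abs_fps (\<lambda>n. of_int (b3 (2 * n))) = euler 1 * (1 + fps_X * theta (\<lambda>k. 15 * tri k + 3 * tri (-k)))"
proof -
  let ?B = "reduce2 (Abs_fps b3)"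
  let ?T = "\<lambda>d. theta (\<lambda>k. 5 * d * tri k + d * tri (-k)) :: bit fps"
  let ?Be = "Abs_fps (\<lambda>n. ?B $ (2 * n))"
  \<comment> \<open>Since \<open>euler 6\<close> is the square of \<open>euler 3\<close>, both sides
    equal \<open>euler 3 ^ 3\<close>.\<close>
  have "?B * euler 6 * euler 1 = ?T 1 * euler 1"
    using reduce2_b3 theta_5_1[of 1] euler_double[of 3]
    by (simp add: power2_eq_square power3_eq_cube mult_ac)
  then have B6: "?B * euler 6 = ?T 1"
    using euler_nonzero[of 1] by simp
  have "(?B * euler 6) $ (2 * n) = (?Be * euler 3) $ n" for n
  proof (rule bisection_mult)
    have eq: "6 * tri k + 2 * 6 * tri (-k) = 2 * (3 * tri k + 2 * 3 * tri (-k))" for k by simp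
    show "euler 6 $ (2 * n) = euler 3 $ n" for n
    proof -
      have "{k. 6 * tri k + 2 * 6 * tri (-k) = 2 * n} = {k. 3 * tri k + 2 * 3 * tri (-k) = n}"
        by (intro Collect_cong) linarith
      then show ?thesis unfolding euler_def theta_nth by simp
    qed
    show "euler 6 $ n = 0" if "odd n" for n
    proof -
      have "{k. 6 * tri k + 2 * 6 * tri (-k) = n} = {}" unfolding eq using that by auto
      then show ?thesis unfolding euler_def theta_nth by simp
    qed
  qed
  then have "?Be * euler 3 = euler 4"
    unfolding B6 using theta_5_1_even by (intro fps_ext) simp
  also have "\<dots> = euler 1 * euler 1 ^ 3"
    using euler_double[of 1] euler_double[of 2] by (simp add: power2_eq_square power3_eq_cube mult_ac)
  \<comment> \<open>By \<open>theta_5_1\<close> with \<open>d = 3\<close>,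
    \<open>euler 9 ^ 3\<close> is \<open>?T 3 * euler 3\<close>, so \<open>euler 3\<close> factors
    out.\<close>
  also have "euler 1 ^ 3 = (1 + fps_X * ?T 3) * euler 3"
    unfolding euler_3_split using theta_5_1[of 3] by (simp add: algebra_simps)
  finally have "?Be * euler 3 = (euler 1 * (1 + fps_X * ?T 3)) * euler 3"
    by (simp only: mult.assoc)
  then show ?thesis
    using euler_nonzero[of 3] by simp
qed

section \<open>Descent by 13\<close>

definition sols :: "nat \<Rightarrow> int set" where
  "sols m = {k. tri k + 2 * tri (-k) = m}"

definition sols2 :: "nat \<Rightarrow> (int \<times> int) set" where
  "sols2 m = {(k, l). tri k + 2 * tri (-k) + (1 + (15 * tri l + 3 * tri (-l))) = m}"

lemma b3_even_card: "of_int (b3 (2 * m)) = (of_nat (card (sols m) + card (sols2 m)) :: bit)"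
proof -
  have fin: "finite {k. 1 + (15 * tri k + 3 * tri (-k)) = m}" for m
    by (rule finite_subset[OF _ finite_tri_combination[of 15 3 "m - 1"]]) auto
  have "euler 1 * (1 + fps_X * theta (\<lambda>k. 15 * tri k + 3 * tri (-k)))
      = euler 1 + euler 1 * (fps_X ^ 1 * theta (\<lambda>k. 15 * tri k + 3 * tri (-k)))"
    by (simp add: algebra_simps)
  also have "\<dots> = theta (\<lambda>k. tri k + 2 * tri (-k)) +
      theta (\<lambda>(k, l). tri k + 2 * tri (-k) + (1 + (15 * tri l + 3 * tri (-l))))"
    unfolding X_power_mult_theta euler_def
    using finite_tri_combination[of 1 2] fin by (subst theta_mult) simp_all
  finally have "Abs_fps (\<lambda>n. of_int (b3 (2 * n)) :: bit) $ m = (theta (\<lambda>k. tri k + 2 * tri (-k)) +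
      theta (\<lambda>(k, l). tri k + 2 * tri (-k) + (1 + (15 * tri l + 3 * tri (-l))))) $ m"
    unfolding b3_even_eq by simp
  then show ?thesis
    by (simp add: sols_def sols2_def del: add_bit_eq_xor)
       (simp add: case_prod_unfold del: add_bit_eq_xor)
qed

lemma sols_iff: "k \<in> sols m \<longleftrightarrow> (6 * k - 1)\<^sup>2 = 24 * int m + 1"
proof -
  have "24 * int (tri k + 2 * tri (-k)) + 1 = (6 * k - 1)\<^sup>2"
    using int_tri[of k] int_tri[of "-k"] by (simp add: power2_eq_square algebra_simps)
  then show ?thesis unfolding sols_def by auto
qed

text \<open>Completing squares: \<open>1 + 15 * tri l + 3 * tri (-l)\<close> is exactly
  \<open>(3 * l + 1)\<^sup>2\<close>.\<close>

lemma sols2_iff: "(k, l) \<in> sols2 m \<longleftrightarrow> (6 * k - 1)\<^sup>2 + 24 * (3 * l + 1)\<^sup>2 = 24 * int m + 1"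
proof -
  have "24 * int (tri k + 2 * tri (-k) + (1 + (15 * tri l + 3 * tri (-l)))) + 1
      = (6 * k - 1)\<^sup>2 + 24 * (3 * l + 1)\<^sup>2"
    using int_tri[of k] int_tri[of "-k"] int_tri[of l] int_tri[of "-l"]
    by (simp add: power2_eq_square algebra_simps)
  then show ?thesis unfolding sols2_def by auto
qed

text \<open>Modulo 13 the form is \<open>x\<^sup>2 - 2 * y\<^sup>2\<close>, and 2 is not a square;
  the finitely many residues are checked directly.\<close>

lemma dvd_13_form:
  fixes x y :: int
  assumes "13 dvd x\<^sup>2 + 24 * y\<^sup>2"
  shows "13 dvd x" "13 dvd y"
proof -
  have "[x\<^sup>2 + 24 * y\<^sup>2 = (x mod 13)\<^sup>2 + 24 * (y mod 13)\<^sup>2] (mod 13)"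
    by (intro cong_add cong_mult cong_pow cong_refl) (simp_all add: cong_def)
  then have "((x mod 13)\<^sup>2 + 24 * (y mod 13)\<^sup>2) mod 13 = 0"
    using assms by (simp only: cong_def dvd_eq_mod_eq_0)
  moreover have "x mod 13 \<in> set [0..12]" "y mod 13 \<in> set [0..12]"
    using pos_mod_bound[of 13 x] pos_mod_bound[of 13 y] pos_mod_sign[of 13 x] pos_mod_sign[of 13 y]
    by (simp_all del: pos_mod_bound pos_mod_sign)
  moreover have "\<forall>a\<in>set [0..12]. \<forall>b\<in>set [0..12]. (a\<^sup>2 + 24 * b\<^sup>2) mod 13 = (0::int) \<longrightarrow> a = 0 \<and> b = 0"
    by code_simp
  ultimately have "x mod 13 = 0 \<and> y mod 13 = 0"
    by metis
  then show "13 dvd x" "13 dvd y" by auto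
qed

text \<open>Then \<open>6 * k - 1 = 13 * (6 * k' - 1)\<close> and
  \<open>3 * l + 1 = 13 * (3 * l' + 1)\<close>, so division by 13 preserves the shape of both
  entries.\<close>

lemma dvd_13_shift:
  fixes k l :: int
  shows "13 dvd 6 * k - 1 \<Longrightarrow> \<exists>k'. k = 13 * k' - 2"
    and "13 dvd 3 * l + 1 \<Longrightarrow> \<exists>l'. l = 13 * l' + 4"
  by presburger+

lemma dvd_13_descent:
  assumes "13 * w = 24 * int n + 13"
  shows "13 dvd n \<and> w = 24 * int (n div 13) + 1"
proof -
  have "24 * int n = 13 * (w - 1)" using assms by simp
  then have "int 13 dvd int (24 * n)" by simp
  then have "13 dvd 24 * n" unfolding int_dvd_int_iff .
  moreover have "coprime 13 (24::nat)" by code_simp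
  ultimately have "13 dvd n" by (simp add: coprime_dvd_mult_right_iff)
  then obtain m where "n = 13 * m" ..
  with assms show ?thesis by simp
qed

text \<open>The residue 7 is chosen because
  \<open>24 * (13 * n + 7) + 1 = 13 * (24 * n + 13)\<close>. Divisibility by 13 forces divisibility
  by 169, hence \<open>13 dvd n\<close>, and the descent divides by 169.\<close>

lemma sols_13: "sols (13 * n + 7) = (if 13 dvd n then (\<lambda>k. 13 * k - 2) ` sols (n div 13) else {})"
proof -
  have "13 dvd n \<and> k \<in> (\<lambda>k. 13 * k - 2) ` sols (n div 13)" if "k \<in> sols (13 * n + 7)" for k
  proof -
    have eq: "(6 * k - 1)\<^sup>2 = 13 * (24 * int n + 13)" using that by (simp add: sols_iff)
    then have "13 dvd 6 * k - 1" using dvd_13_form(1)[of "6 * k - 1" 0] by simp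
    then obtain k' where k: "k = 13 * k' - 2" using dvd_13_shift(1) by blast
    have "13 * (6 * k' - 1)\<^sup>2 = 24 * int n + 13"
      using eq unfolding k by (simp add: power2_eq_square algebra_simps)
    from dvd_13_descent[OF this] show ?thesis
      unfolding k by (auto simp: sols_iff)
  qed
  moreover have "13 * k - 2 \<in> sols (13 * n + 7)" if "13 dvd n" "k \<in> sols (n div 13)" for k
    using that by (auto simp: sols_iff power2_eq_square algebra_simps elim!: dvdE)
  ultimately show ?thesis by auto
qed

lemma sols2_13: "sols2 (13 * n + 7) =
  (if 13 dvd n then (\<lambda>(k, l). (13 * k - 2, 13 * l + 4)) ` sols2 (n div 13) else {})"
proof -
  have "13 dvd n \<and> (k, l) \<in> (\<lambda>(k, l). (13 * k - 2, 13 * l + 4)) ` sols2 (n div 13)"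
    if "(k, l) \<in> sols2 (13 * n + 7)" for k l
  proof -
    have eq: "(6 * k - 1)\<^sup>2 + 24 * (3 * l + 1)\<^sup>2 = 13 * (24 * int n + 13)"
      using that by (simp add: sols2_iff)
    then have "13 dvd 6 * k - 1" "13 dvd 3 * l + 1"
      using dvd_13_form[of "6 * k - 1" "3 * l + 1"] by simp_all
    then obtain k' l' where k: "k = 13 * k' - 2" and l: "l = 13 * l' + 4"
      using dvd_13_shift by blast
    have "13 * ((6 * k' - 1)\<^sup>2 + 24 * (3 * l' + 1)\<^sup>2) = 24 * int n + 13"
      using eq unfolding k l by (simp add: power2_eq_square algebra_simps)
    from dvd_13_descent[OF this] show ?thesis
      unfolding k l by (auto simp: sols2_iff intro!: image_eqI[of _ _ "(k', l')"])
  qed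
  moreover have "(13 * k - 2, 13 * l + 4) \<in> sols2 (13 * n + 7)"
    if "13 dvd n" "(k, l) \<in> sols2 (n div 13)" for k l
    using that by (auto simp: sols2_iff power2_eq_square algebra_simps elim!: dvdE)
  ultimately show ?thesis by auto
qed

section \<open>The parity congruences for \<open>b3\<close>\<close>

lemma b3_descent:
  "[b3 (2 * (13 * n + 7)) = (if 13 dvd n then b3 (2 * (n div 13)) else 0)] (mod 2)"
proof -
  have "card (sols (13 * n + 7)) = (if 13 dvd n then card (sols (n div 13)) else 0)"
    unfolding sols_13 by (simp add: card_image inj_on_def)
  moreover have "card (sols2 (13 * n + 7)) = (if 13 dvd n then card (sols2 (n div 13)) else 0)"
    unfolding sols2_13 by (auto simp: inj_on_def intro!: card_image)
  ultimately have "of_int (b3 (2 * (13 * n + 7)))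
      = (of_int (if 13 dvd n then b3 (2 * (n div 13)) else 0) :: bit)"
    by (cases "13 dvd n") (simp_all only: b3_even_card if_True if_False of_int_0 of_nat_0 add_0)
  then show ?thesis by (simp only: of_int_bit_eq_iff)
qed

text \<open>The argument is that of the theorem for \<open>k = j + 1\<close>, with the factor 2
  pulled out. Each step of the induction applies \<open>b3_descent\<close> to a multiple of 13 and
  so returns to \<open>j\<close>.\<close>

lemma b3_vanish:
  "[b3 (2 * (13 ^ (2 * j) * (169 * n + 20) + 7 * ((13 ^ (2 * j) - 1) div 168))) = 0] (mod 2)"
proof (induction j)
  case 0
  \<comment> \<open>Here \<open>169 * n + 20 = 13 * (13 * n + 1) + 7\<close>.\<close>
  have "\<not> 13 dvd 13 * n + 1" by presburger
  then show ?case using b3_descent[of "13 * n + 1"] by (simp add: algebra_simps)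
next
  case (Suc j)
  define x :: nat where "x = 13 ^ (2 * j)"
  define M where "M = x * (169 * n + 20) + 7 * ((x - 1) div 168)"
  \<comment> \<open>Since 168 is \<open>13 ^ 2 - 1\<close>, the division is exact, and the quotient
    is a geometric sum that obeys \<open>y \<mapsto> 169 * y + 1\<close>.\<close>
  have "[(169::nat) ^ j = 1 ^ j] (mod 168)" by (intro cong_pow) (simp add: cong_def)
  then have "x mod 168 = 1" by (simp add: x_def power_mult cong_def)
  then obtain y where x: "x = 168 * y + 1"
    by (metis mult_div_mod_eq)
  then have "x - 1 = 168 * y" "169 * x - 1 = 168 * (169 * y + 1)" by simp_all
  then have "(169 * x - 1) div 168 = 169 * ((x - 1) div 168) + 1"
    by (simp only: nonzero_mult_div_cancel_left zero_neq_numeral not_False_eq_True)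
  moreover have "13 ^ (2 * Suc j) = 169 * x" by (simp add: x_def)
  ultimately have "13 ^ (2 * Suc j) * (169 * n + 20) + 7 * ((13 ^ (2 * Suc j) - 1) div 168)
      = 169 * x * (169 * n + 20) + 7 * (169 * ((x - 1) div 168) + 1)"
    by (simp only:)
  also have "\<dots> = 13 * (13 * M) + 7"
    by (simp add: M_def algebra_simps)
  finally have "13 ^ (2 * Suc j) * (169 * n + 20) + 7 * ((13 ^ (2 * Suc j) - 1) div 168)
      = 13 * (13 * M) + 7" .
  moreover have "[b3 (2 * (13 * (13 * M) + 7)) = b3 (2 * M)] (mod 2)"
    using b3_descent[of "13 * M"] by simp
  moreover have "[b3 (2 * M) = 0] (mod 2)"
    using Suc.IH by (simp only: M_def x_def)
  ultimately show ?case by (metis cong_trans)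
qed

theorem theorem2p3:
  shows "fps_cong (Abs_fps (\<lambda>n. b3 (26 * n + 14)))
           (Abs_fps (\<lambda>n. b3 (2 * n)) oo fps_X ^ 13) 2 \<and>
         (\<forall>n. [b3 (2 * 13 ^ 2 * n + 40) = 0] (mod 2)) \<and>
         (\<forall>k n. k \<ge> 1 \<longrightarrow>
           [b3 (2 * 13 ^ (2 * k) * n + 13 ^ (2 * k - 2) * 40
                + 14 * ((13 ^ (2 * k - 2) - 1) div 168)) = 0] (mod 2))"
proof (intro conjI allI impI)
  show "fps_cong (Abs_fps (\<lambda>n. b3 (26 * n + 14))) (Abs_fps (\<lambda>n. b3 (2 * n)) oo fps_X ^ 13) 2"
    unfolding fps_cong_def
  proof
    fix n :: nat
    have "26 * n + 14 = 2 * (13 * n + 7)" by simp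
    then show "[Abs_fps (\<lambda>n. b3 (26 * n + 14)) $ n = (Abs_fps (\<lambda>n. b3 (2 * n)) oo fps_X ^ 13) $ n] (mod 2)"
      using b3_descent[of n] by (cases "13 dvd n") (simp_all add: fps_nth_compose_X_power)
  qed
  show "[b3 (2 * 13 ^ 2 * n + 40) = 0] (mod 2)" for n
    using b3_vanish[of 0 n] by simp
  show "[b3 (2 * 13 ^ (2 * k) * n + 13 ^ (2 * k - 2) * 40
      + 14 * ((13 ^ (2 * k - 2) - 1) div 168)) = 0] (mod 2)" if k1: "k \<ge> 1" for k n
  proof -
    obtain j where k: "k = Suc j" using k1 by (cases k) auto
    have "2 * 13 ^ (2 * k) * n + 13 ^ (2 * k - 2) * 40 + 14 * ((13 ^ (2 * k - 2) - 1) div 168)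
        = 2 * (13 ^ (2 * j) * (169 * n + 20) + 7 * ((13 ^ (2 * j) - 1) div 168))"
      by (simp add: k algebra_simps)
    then show ?thesis using b3_vanish by simp
  qed
qed

end
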